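(* Let $X\in\mathbb{R}^{n\times p}$ have columns in general position, $y\in\mathbb{R}^n$, $\lambda_{\mathrm L}>0$, and let $E$ and $s$ be the Lasso equicorrelation set and equicorrelation sign vector. Let $\phi\in[0,1)$ and let $$\hat\beta_{\mathrm{rel}}(\phi)\in\arg\min_{\beta\in\mathbb{R}^p,\ \beta_{-E}=0}\left\{\frac1{2n}\|y-X\beta\|_2^2+\phi\lambda_{\mathrm L}\|\beta_E\|_1\right\}.$$ Let $A_\phi$ be a real matrix with $|E|$ columns such that $$A_\phi^\top A_\phi=\frac{\phi}{1-\phi}\Sigma_{n,E}.$$ If $\operatorname{supp}(\hat\beta_{\mathrm{rel}}(\phi))=E$ and $\operatorname{sign}(\hat\beta_{\mathrm{rel},E}(\phi))=s$, then the generalized Lasso--Ridge estimator associated with $A_\phi$ satisfies $$\hat\beta_{A_\phi}=\hat\beta_{\mathrm{rel}}(\phi).$$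
   Context: Notation: $X_S$ is the submatrix of columns of $X$ indexed by $S\subseteq\{1,\dots,p\}$; $v_S$, $v_{-S}$ are the subvectors of $v$ indexed by $S$ and its complement. Zero-dimensional vectors and matrices are allowed. General position: for every integer $0\le k<\min\{n,p\}$, no $k$-dimensional affine subspace of $\mathbb{R}^n$ contains more than $k+1$ elements of $\{\pm X_1,\dots,\pm X_p\}$, excluding antipodal pairs (i.e. for any distinct indices $i_1,\dots,i_{k+2}$ and any signs $\sigma_1,\dots,\sigma_{k+2}\in\{\pm1\}$, the vectors $\sigma_1X_{i_1},\dots,\sigma_{k+2}X_{i_{k+2}}$ do not all lie in a $k$-dimensional affine subspace). Under general position the Lasso minimizer below is unique and $X_E$ has full column rank. Lasso: $\hat\beta_{\mathrm L}=\arg\min_{\beta\in\mathbb{R}^p}\{\frac1{2n}\|y-X\beta\|_2^2+\lambda_{\mathrm L}\|\beta\|_1\}$. Equicorrelation set: $E=\{j:|\frac1nX_j^\top(y-X\hat\beta_{\mathrm L})|=\lambda_{\mathrm L}\}$. Sign vector: $s=\operatorname{sign}(X_E^\top(y-X\hat\beta_{\mathrm L}))\in\{-1,1\}^{|E|}$. Restricted Gram matrix: $\Sigma_{n,E}=\frac1nX_E^\top X_E$. Generalized Lasso--Ridge estimator associated with $A\in\mathbb{R}^{q\times|E|}$: $\hat\beta_A=\hat\beta_{\mathrm L}+\hat\delta_A$, where $\hat\delta_A$ is the minimizer over $\delta\in\mathbb{R}^p$ with $\delta_{-E}=0$ of $\frac1{2n}\|y-X\hat\beta_{\mathrm L}-X\delta\|_2^2+\frac12\|A\delta_E\|_2^2$.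 *)

theory Defs
  imports "HOL-Analysis.Analysis"
begin

text \<open>
  A design matrix is \<open>X :: real ^ 'p ^ 'n\<close>, with \<open>n = CARD('n)\<close> rows and \<open>p = CARD('p)\<close>
  columns \<open>column j X\<close>. Subvectors and submatrices indexed by a set \<open>E\<close> of columns keep their
  original index set: a vector in \<open>\<real>\<^sup>E\<close> is given by its entries at \<open>j \<in> E\<close>, and a matrix with
  \<open>q\<close> rows and \<open>card E\<close> columns is a function \<open>A\<close> of which only the entries \<open>A i j\<close> with
  \<open>i < q\<close> and \<open>j \<in> E\<close> are used. Both \<open>q = 0\<close> and \<open>E = {}\<close> are allowed.
\<close>

definition general_position :: "real ^ 'p ^ 'n \<Rightarrow> bool" where
  "general_position X \<longleftrightarrow>
     (\<forall>k < min CARD('n) CARD('p). \<forall>T :: (real ^ 'n) set. affine T \<and> aff_dim T = int k \<longrightarrow>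
        (\<forall>(I :: 'p set) (\<sigma> :: 'p \<Rightarrow> real). card I = k + 2 \<and> (\<forall>j\<in>I. \<sigma> j \<in> {-1, 1}) \<longrightarrow>
           \<not> (\<forall>j\<in>I. \<sigma> j *\<^sub>R column j X \<in> T)))"

definition l1_norm_on :: "'p set \<Rightarrow> real ^ 'p \<Rightarrow> real" where
  "l1_norm_on S v = (\<Sum>j\<in>S. \<bar>v $ j\<bar>)"

definition least_squares_loss :: "real ^ 'p ^ 'n \<Rightarrow> real ^ 'n \<Rightarrow> real ^ 'p \<Rightarrow> real" where
  "least_squares_loss X y \<beta> = 1 / (2 * real CARD('n)) * (norm (y - X *v \<beta>))\<^sup>2"

definition vanishes_off :: "'p set \<Rightarrow> real ^ 'p \<Rightarrow> bool" where
  "vanishes_off S v \<longleftrightarrow> (\<forall>j. j \<notin> S \<longrightarrow> v $ j = 0)"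

definition vec_support :: "real ^ 'p \<Rightarrow> 'p set" where
  "vec_support v = {j. v $ j \<noteq> 0}"

definition lasso :: "real ^ 'p ^ 'n \<Rightarrow> real ^ 'n \<Rightarrow> real \<Rightarrow> real ^ 'p" where
  "lasso X y lam = arg_min (\<lambda>\<beta>. least_squares_loss X y \<beta> + lam * l1_norm_on UNIV \<beta>) (\<lambda>_. True)"

definition equicorrelation_set :: "real ^ 'p ^ 'n \<Rightarrow> real ^ 'n \<Rightarrow> real \<Rightarrow> 'p set" where
  "equicorrelation_set X y lam =
     {j. \<bar>1 / real CARD('n) * (column j X \<bullet> (y - X *v lasso X y lam))\<bar> = lam}"

text \<open>Only the values of the sign vector at indices in the equicorrelation set are meaningful.\<close>

definition equicorrelation_sign :: "real ^ 'p ^ 'n \<Rightarrow> real ^ 'n \<Rightarrow> real \<Rightarrow> 'p \<Rightarrow> real" where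
  "equicorrelation_sign X y lam j = sgn (column j X \<bullet> (y - X *v lasso X y lam))"

definition gram :: "real ^ 'p ^ 'n \<Rightarrow> real ^ 'p ^ 'p" where
  "gram X = (1 / real CARD('n)) *\<^sub>R (transpose X ** X)"

definition is_relaxed_lasso ::
  "real ^ 'p ^ 'n \<Rightarrow> real ^ 'n \<Rightarrow> real \<Rightarrow> real \<Rightarrow> real ^ 'p \<Rightarrow> bool" where
  "is_relaxed_lasso X y lam \<phi> =
     is_arg_min
       (\<lambda>\<beta>. least_squares_loss X y \<beta> + \<phi> * lam * l1_norm_on (equicorrelation_set X y lam) \<beta>)
       (vanishes_off (equicorrelation_set X y lam))"

definition lasso_ridge_correction ::
  "real ^ 'p ^ 'n \<Rightarrow> real ^ 'n \<Rightarrow> real \<Rightarrow> nat \<Rightarrow> (nat \<Rightarrow> 'p \<Rightarrow> real) \<Rightarrow> real ^ 'p" where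
  "lasso_ridge_correction X y lam q A =
     arg_min
       (\<lambda>\<delta>. least_squares_loss X (y - X *v lasso X y lam) \<delta>
            + 1 / 2 * (\<Sum>i<q. (\<Sum>j\<in>equicorrelation_set X y lam. A i j * \<delta> $ j)\<^sup>2))
       (vanishes_off (equicorrelation_set X y lam))"

definition lasso_ridge ::
  "real ^ 'p ^ 'n \<Rightarrow> real ^ 'n \<Rightarrow> real \<Rightarrow> nat \<Rightarrow> (nat \<Rightarrow> 'p \<Rightarrow> real) \<Rightarrow> real ^ 'p" where
  "lasso_ridge X y lam q A = lasso X y lam + lasso_ridge_correction X y lam q A"

end

theory Submission
  imports Defs
begin

text \<open>
  Write \<open>r\<close> for the Lasso residual. Stationarity gives \<open>X\<^sub>j \<bullet> r / n = \<lambda> s\<^sub>j\<close> and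
  \<open>X\<^sub>j \<bullet> (y - X \<beta>_rel) / n = \<phi> \<lambda> s\<^sub>j\<close> on \<open>E\<close>, so \<open>\<delta>\<^sub>0 = \<beta>_rel - \<beta>_L\<close>, which vanishes off \<open>E\<close>,
  satisfies \<open>X\<^sub>j \<bullet> X \<delta>\<^sub>0 = (1 - \<phi>) X\<^sub>j \<bullet> r\<close> for \<open>j \<in> E\<close>. Completing the square, the
  Lasso--Ridge objective at \<open>\<delta>\<close> is a constant plus \<open>\<parallel>X (\<delta> - \<delta>\<^sub>0)\<parallel>\<^sup>2 / (2 n (1 - \<phi>))\<close>.
  The minimizer is unique because \<open>X\<^sub>E\<close> is injective: all \<open>s\<^sub>j X\<^sub>j\<close> with \<open>j \<in> E\<close> lie in the
  hyperplane \<open>{x. x \<bullet> r = n \<lambda>}\<close>, which misses the origin, so a linear relation between them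
  is an affine one, and general position excludes those.
\<close>

section \<open>Column expansions of inner products and Gram entries\<close>

lemma inner_matrix_vector_mult:
  fixes X :: "real ^ 'p ^ 'n"
  shows "u \<bullet> (X *v v) = (\<Sum>j\<in>UNIV. v $ j * (column j X \<bullet> u))"
  by (simp add: matrix_mult_sum inner_sum_right scalar_mult_eq_scaleR inner_commute)

lemma gram_nth:
  fixes X :: "real ^ 'p ^ 'n"
  shows "gram X $ j $ k = (column j X \<bullet> column k X) / real CARD('n)"
  by (simp add: gram_def matrix_matrix_mult_def transpose_def column_def inner_vec_def)

lemma sum_vanishes_off:
  assumes "vanishes_off E v"
  shows "(\<Sum>j\<in>UNIV. v $ j * f j) = (\<Sum>j\<in>E. v $ j * f j)"
  by (rule sum.mono_neutral_right) (use assms in \<open>auto simp: vanishes_off_def\<close>)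

section \<open>Stationarity along coordinate axes\<close>

lemma least_squares_loss_add_axis:
  fixes X :: "real ^ 'p ^ 'n"
  shows "least_squares_loss X y (b + axis j t) = least_squares_loss X y b
    - t * (column j X \<bullet> (y - X *v b) / real CARD('n))
    + t\<^sup>2 * ((norm (column j X))\<^sup>2 / (2 * real CARD('n)))"
proof -
  have ax: "X *v axis j t = t *\<^sub>R column j X"
    by (simp add: vec_eq_iff matrix_vector_mult_def axis_def column_def if_distrib
        mult.commute cong: if_cong)
  have "(norm (y - X *v (b + axis j t)))\<^sup>2
      = (norm (y - X *v b))\<^sup>2 - 2 * t * (column j X \<bullet> (y - X *v b)) + t\<^sup>2 * (norm (column j X))\<^sup>2"
    unfolding matrix_vector_right_distrib ax power2_norm_eq_inner
    by (simp add: algebra_simps inner_commute power2_eq_square)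
  then show ?thesis
    unfolding least_squares_loss_def by (simp add: field_simps)
qed

lemma l1_norm_on_add_axis:
  assumes "j \<in> S"
  shows "l1_norm_on S (b + axis j t) = l1_norm_on S b + (\<bar>b $ j + t\<bar> - \<bar>b $ j\<bar>)"
proof -
  have "l1_norm_on (S - {j}) (b + axis j t) = l1_norm_on (S - {j}) b"
    unfolding l1_norm_on_def by (rule sum.cong) (auto simp: axis_def)
  with assms show ?thesis
    unfolding l1_norm_on_def by (simp add: sum.remove[of S j] axis_def)
qed

text \<open>While \<open>\<bar>t\<bar> < \<bar>b\<bar>\<close>, the sign of \<open>b + t\<close> is
  that of \<open>b\<close>, so the absolute-value term is linear in \<open>t\<close>. Near 0 the
  expression is thus a smooth function with a minimum at 0, and its derivative there
  vanishes.\<close>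

lemma penalized_quadratic_stationary:
  fixes b g c \<mu> :: real
  assumes nz: "b \<noteq> 0"
    and min: "\<And>t. - t * g + t\<^sup>2 * c + \<mu> * (\<bar>b + t\<bar> - \<bar>b\<bar>) \<ge> 0"
  shows "g = \<mu> * sgn b"
proof -
  let ?f = "\<lambda>t::real. t * (\<mu> * sgn b - g) + t\<^sup>2 * c"
  have d: "(?f has_real_derivative (\<mu> * sgn b - g)) (at 0)"
    by (auto intro!: derivative_eq_intros)
  have "?f 0 \<le> ?f t" if "\<bar>0 - t\<bar> < \<bar>b\<bar>" for t
  proof -
    have "\<bar>b + t\<bar> - \<bar>b\<bar> = t * sgn b"
      using that nz by (auto simp: sgn_if abs_if split: if_splits)
    then show ?thesis using min[of t] by (simp add: algebra_simps)
  qed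
  then have "\<mu> * sgn b - g = 0"
    using DERIV_local_min[OF d, of "\<bar>b\<bar>"] nz by auto
  then show ?thesis by simp
qed

text \<open>A move along axis \<open>j\<close> in \<open>S\<close> stays feasible and reduces the
  claim to one variable. \<open>S = UNIV\<close> serves the Lasso, and \<open>S = E\<close> the
  relaxed Lasso.\<close>

lemma penalized_least_squares_stationary:
  fixes X :: "real ^ 'p ^ 'n"
  assumes min: "is_arg_min (\<lambda>\<beta>. least_squares_loss X y \<beta> + \<mu> * l1_norm_on S \<beta>) (vanishes_off S) b"
    and j: "j \<in> S" and nz: "b $ j \<noteq> 0"
  shows "column j X \<bullet> (y - X *v b) / real CARD('n) = \<mu> * sgn (b $ j)"
proof (rule penalized_quadratic_stationary[OF nz])
  fix t
  have "vanishes_off S (b + axis j t)"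
    using min j by (auto simp: is_arg_min_def vanishes_off_def axis_def)
  then have "least_squares_loss X y b + \<mu> * l1_norm_on S b
      \<le> least_squares_loss X y (b + axis j t) + \<mu> * l1_norm_on S (b + axis j t)"
    using min by (auto simp: is_arg_min_linorder)
  then show "0 \<le> - t * (column j X \<bullet> (y - X *v b) / real CARD('n))
      + t\<^sup>2 * ((norm (column j X))\<^sup>2 / (2 * real CARD('n))) + \<mu> * (\<bar>b $ j + t\<bar> - \<bar>b $ j\<bar>)"
    unfolding least_squares_loss_add_axis l1_norm_on_add_axis[OF j] distrib_left
    by linarith
qed

section \<open>Existence of the Lasso minimizer and its support\<close>

text \<open>\<open>lasso\<close> is a choice term, so it has the minimizing property only once some
  minimizer exists. One exists by continuity and coercivity: the objective dominates
  \<open>lam * norm \<beta>\<close>.\<close>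

lemma lasso_is_arg_min:
  fixes X :: "real ^ 'p ^ 'n"
  assumes lam: "lam > 0"
  shows "is_arg_min (\<lambda>\<beta>. least_squares_loss X y \<beta> + lam * l1_norm_on UNIV \<beta>) (\<lambda>_. True)
    (lasso X y lam)"
proof -
  let ?f = "\<lambda>\<beta>. least_squares_loss X y \<beta> + lam * l1_norm_on UNIV \<beta>"
  have loss_nonneg: "least_squares_loss X y \<beta> \<ge> 0" for \<beta>
    by (simp add: least_squares_loss_def)
  have lower: "lam * norm \<beta> \<le> ?f \<beta>" for \<beta>
    unfolding l1_norm_on_def
    using mult_left_mono[OF norm_le_l1_cart[of \<beta>], of lam] lam loss_nonneg[of \<beta>] by linarith
  \<comment> \<open>Outside this ball the lower bound already exceeds the value at 0, so a minimizer
    over the ball is a global one.\<close>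
  define R where "R = ?f 0 / lam"
  have R: "R \<ge> 0"
    using lower[of 0] lam by (simp add: R_def)
  have "continuous_on (cball 0 R) ?f"
    unfolding least_squares_loss_def l1_norm_on_def
    by (intro continuous_intros matrix_vector_mult_linear_continuous_on)
  then obtain m where m: "m \<in> cball 0 R" "\<And>z. z \<in> cball 0 R \<Longrightarrow> ?f m \<le> ?f z"
    using continuous_attains_inf[of "cball (0 :: real ^ 'p) R" ?f] R by auto
  have "?f m \<le> ?f z" for z
  proof (cases "z \<in> cball 0 R")
    case False
    then have "?f 0 < lam * norm z"
      using lam by (simp add: R_def field_simps)
    with lower[of z] m(2)[of 0] R show ?thesis by simp
  qed (rule m(2))
  then have "is_arg_min ?f (\<lambda>_. True) m"
    by (simp add: is_arg_min_linorder)
  then show ?thesis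
    unfolding lasso_def arg_min_def by (rule someI)
qed

lemma lasso_vanishes_off_equicorrelation_set:
  fixes X :: "real ^ 'p ^ 'n"
  assumes lam: "lam > 0"
  shows "vanishes_off (equicorrelation_set X y lam) (lasso X y lam)"
  unfolding vanishes_off_def
proof (intro allI impI, rule ccontr)
  fix j
  assume j: "j \<notin> equicorrelation_set X y lam" and nz: "lasso X y lam $ j \<noteq> 0"
  \<comment> \<open>With \<open>S = UNIV\<close> the support constraint is trivial, which casts the
    Lasso in the form of the stationarity lemma.\<close>
  have "vanishes_off UNIV = (\<lambda>_ :: real ^ 'p. True)"
    by (auto simp: vanishes_off_def)
  then have "is_arg_min (\<lambda>\<beta>. least_squares_loss X y \<beta> + lam * l1_norm_on UNIV \<beta>)
      (vanishes_off UNIV) (lasso X y lam)"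
    using lasso_is_arg_min[OF lam] by simp
  then have "column j X \<bullet> (y - X *v lasso X y lam) / real CARD('n) = lam * sgn (lasso X y lam $ j)"
    using nz by (rule penalized_least_squares_stationary[OF _ UNIV_I])
  then have "\<bar>column j X \<bullet> (y - X *v lasso X y lam) / real CARD('n)\<bar> = lam"
    using nz lam by (simp add: abs_mult abs_sgn_eq)
  with j show False
    by (simp add: equicorrelation_set_def)
qed

lemma equicorrelation:
  fixes X :: "real ^ 'p ^ 'n"
  assumes "j \<in> equicorrelation_set X y lam"
  shows "column j X \<bullet> (y - X *v lasso X y lam) / real CARD('n)
    = lam * equicorrelation_sign X y lam j"
proof -
  let ?g = "column j X \<bullet> (y - X *v lasso X y lam)"
  have "\<bar>?g\<bar> = real CARD('n) * lam"
    using assms by (auto simp: equicorrelation_set_def field_simps)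
  then have "?g = real CARD('n) * lam * sgn ?g"
    by (metis abs_mult_sgn)
  then show ?thesis
    unfolding equicorrelation_sign_def by (simp add: field_simps)
qed

section \<open>General position and injectivity on the equicorrelation set\<close>

text \<open>On a hyperplane missing the origin, a linear combination that stays on it has
  coefficients summing to 1, hence is affine. Written over an independent set \<open>B\<close>, it
  puts \<open>card B + 1\<close> signed columns in an affine space of dimension
  \<open>card B - 1\<close>, which general position forbids.\<close>

lemma general_position_not_in_span:
  fixes X :: "real ^ 'p ^ 'n" and s :: "'p \<Rightarrow> real"
  assumes gp: "general_position X"
    and s: "\<And>j. j \<in> E \<Longrightarrow> s j \<in> {-1, 1}"
    and hyper: "\<And>j. j \<in> E \<Longrightarrow> (s j *\<^sub>R column j X) \<bullet> r = c" and c: "c \<noteq> 0"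
    and i: "i \<in> E"
  shows "s i *\<^sub>R column i X \<notin> span ((\<lambda>j. s j *\<^sub>R column j X) ` (E - {i}))"
proof
  define w where "w = (\<lambda>j. s j *\<^sub>R column j X)"
  assume "s i *\<^sub>R column i X \<in> span ((\<lambda>j. s j *\<^sub>R column j X) ` (E - {i}))"
  then have wi: "w i \<in> span (w ` (E - {i}))"
    by (simp add: w_def)
  obtain B where B: "B \<subseteq> w ` (E - {i})" "independent B" "w ` (E - {i}) \<subseteq> span B"
    using maximal_independent_subset by metis
  have fin: "finite B" and cardB: "card B \<le> CARD('n)"
    using independent_bound[OF B(2)] by auto
  from wi have "w i \<in> span B"
    using B(3) span_minimal subspace_span by blast
  then obtain u where u: "(\<Sum>b\<in>B. u b *\<^sub>R b) = w i"
    using span_finite[OF fin] by auto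
  \<comment> \<open>Pairing the combination with \<open>r\<close> gives \<open>c\<close> times the
    coefficient sum; dividing by \<open>c\<close> shows that the sum is 1.\<close>
  have "c = (\<Sum>b\<in>B. u b *\<^sub>R b) \<bullet> r"
    using hyper[OF i] u by (simp add: w_def)
  also have "\<dots> = (\<Sum>b\<in>B. u b * c)"
    using B(1) hyper by (auto simp: inner_sum_left w_def intro!: sum.cong)
  finally have "(\<Sum>b\<in>B. u b) = 1"
    using c by (simp flip: sum_distrib_right)
  then have hull: "w i \<in> affine hull B" and ne: "B \<noteq> {}"
    using u by (auto simp: affine_hull_finite[OF fin])
  \<comment> \<open>General position counts indices, and different indices may carry the same
    vector, so one index is picked for each element of \<open>B\<close>.\<close>
  obtain J where J: "J \<subseteq> E - {i}" "inj_on w J" "B = w ` J"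
    using B(1) by (metis subset_image_inj)
  define k where "k = card B - 1"
  have k: "card B = k + 1"
    using ne fin by (simp add: k_def card_gt_0_iff Suc_leI)
  have "card (insert i J) = k + 2"
    using J k by (subst card_insert_disjoint) (auto simp: card_image)
  moreover have "card (insert i J) \<le> CARD('p)"
    by (rule card_mono) auto
  \<comment> \<open>The bound by \<open>n\<close> comes from independence of the
    \<open>k + 1\<close> vectors in \<open>B\<close>, the bound by \<open>p\<close> from the
    \<open>k + 2\<close> distinct indices.\<close>
  ultimately have "k < min CARD('n) CARD('p)"
    using k cardB by simp
  moreover have "aff_dim (affine hull B) = int k"
    using aff_dim_affine_independent[of B] B(2) affine_dependent_imp_dependent k by force
  moreover have "\<forall>j\<in>insert i J. s j \<in> {-1, 1}"
    using s i J(1) by blast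
  moreover have "\<forall>j\<in>insert i J. s j *\<^sub>R column j X \<in> affine hull B"
    using hull J(3) by (auto simp: w_def intro: hull_inc)
  ultimately show False
    using gp \<open>card (insert i J) = k + 2\<close> affine_affine_hull unfolding general_position_def by blast
qed

text \<open>This is full column rank of the submatrix on \<open>E\<close>. A nonzero kernel vector
  would express one signed column through the others.\<close>

lemma equicorrelation_injective:
  fixes X :: "real ^ 'p ^ 'n"
  assumes gp: "general_position X" and lam: "lam > 0"
    and off: "vanishes_off (equicorrelation_set X y lam) d" and null: "X *v d = 0"
  shows "d = 0"
proof (rule ccontr)
  define E where "E = equicorrelation_set X y lam"
  define s where "s = equicorrelation_sign X y lam"
  define w where "w = (\<lambda>j. s j *\<^sub>R column j X)"
  assume "d \<noteq> 0"
  then obtain i where di: "d $ i \<noteq> 0"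
    by (auto simp: vec_eq_iff)
  with off have i: "i \<in> E"
    by (auto simp: vanishes_off_def E_def)
  have s: "s j \<in> {-1, 1}" if "j \<in> E" for j
    using that lam
    by (auto simp: s_def E_def equicorrelation_sign_def equicorrelation_set_def sgn_if)
  have hyper: "(s j *\<^sub>R column j X) \<bullet> (y - X *v lasso X y lam) = real CARD('n) * lam"
    if "j \<in> E" for j
  proof -
    have "column j X \<bullet> (y - X *v lasso X y lam) = real CARD('n) * lam * s j"
      using equicorrelation[of j X y lam] that by (simp add: E_def s_def field_simps)
    then show ?thesis
      using s[OF that] by auto
  qed
  have in_span: "d $ j *\<^sub>R column j X \<in> span (w ` (E - {i}))" if "j \<in> UNIV - {i}" for j
  proof (cases "j \<in> E")
    case True
    then have "d $ j *\<^sub>R column j X = (d $ j * s j) *\<^sub>R w j"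
      using s[OF True] by (auto simp: w_def)
    with True that show ?thesis
      by (auto intro: span_scale span_base)
  next
    case False
    with off show ?thesis
      by (simp add: vanishes_off_def E_def span_zero)
  qed
  have "(\<Sum>j\<in>UNIV. d $ j *\<^sub>R column j X) = 0"
    using null by (simp add: matrix_mult_sum scalar_mult_eq_scaleR)
  then have "d $ i *\<^sub>R column i X = - (\<Sum>j\<in>UNIV - {i}. d $ j *\<^sub>R column j X)"
    by (simp add: sum.remove[of UNIV i] eq_neg_iff_add_eq_0)
  then have "d $ i *\<^sub>R column i X \<in> span (w ` (E - {i}))"
    using in_span by (simp only: span_neg span_sum)
  then have "(s i / d $ i) *\<^sub>R d $ i *\<^sub>R column i X \<in> span (w ` (E - {i}))"
    by (rule span_scale)
  then have "s i *\<^sub>R column i X \<in> span (w ` (E - {i}))"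
    using di by simp
  then show False
    using general_position_not_in_span[OF gp s hyper _ i] lam by (simp add: w_def)
qed

section \<open>The ridge penalty and the main result\<close>

text \<open>The penalty is the quadratic form of the Gram matrix of \<open>A\<close>, which on
  \<open>E\<close> is \<open>a\<close> times that of \<open>X\<close>. It is therefore a multiple of
  the squared fit and can be merged with the loss.\<close>

lemma ridge_penalty_eq:
  fixes X :: "real ^ 'p ^ 'n"
  assumes A: "\<forall>j\<in>E. \<forall>k\<in>E. (\<Sum>i<q. A i j * A i k) = a * gram X $ j $ k"
    and off: "vanishes_off E d"
  shows "(\<Sum>i<q. (\<Sum>j\<in>E. A i j * d $ j)\<^sup>2) = a * (norm (X *v d))\<^sup>2 / real CARD('n)"
proof -
  have "(\<Sum>i<q. (\<Sum>j\<in>E. A i j * d $ j)\<^sup>2)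
      = (\<Sum>i<q. \<Sum>j\<in>E. \<Sum>k\<in>E. d $ j * (d $ k * (A i j * A i k)))"
    by (simp add: power2_eq_square sum_product ac_simps)
  also have "\<dots> = (\<Sum>j\<in>E. \<Sum>i<q. \<Sum>k\<in>E. d $ j * (d $ k * (A i j * A i k)))"
    by (rule sum.swap)
  also have "\<dots> = (\<Sum>j\<in>E. \<Sum>k\<in>E. \<Sum>i<q. d $ j * (d $ k * (A i j * A i k)))"
    by (rule sum.cong[OF refl], rule sum.swap)
  also have "\<dots> = (\<Sum>j\<in>E. d $ j * (\<Sum>k\<in>E. d $ k * (\<Sum>i<q. A i j * A i k)))"
    by (simp add: sum_distrib_left)
  also have "\<dots> = (\<Sum>j\<in>E. d $ j * (\<Sum>k\<in>E. d $ k * (a * gram X $ j $ k)))"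
    using A by (intro sum.cong refl arg_cong2[where f = "(*)"]) auto
  also have "\<dots> = a / real CARD('n) *
      (\<Sum>j\<in>E. d $ j * (\<Sum>k\<in>E. d $ k * (column k X \<bullet> column j X)))"
    by (simp add: gram_nth sum_distrib_left ac_simps inner_commute)
  also have "(\<Sum>j\<in>E. d $ j * (\<Sum>k\<in>E. d $ k * (column k X \<bullet> column j X)))
      = (norm (X *v d))\<^sup>2"
    by (simp add: power2_norm_eq_inner inner_matrix_vector_mult sum_vanishes_off[OF off])
  finally show ?thesis by simp
qed

theorem mainTheorem6:
  fixes X :: "real ^ 'p ^ 'n" and y :: "real ^ 'n" and lam \<phi> :: real
    and \<beta>_rel :: "real ^ 'p" and q :: nat and A :: "nat \<Rightarrow> 'p \<Rightarrow> real"
  assumes "general_position X"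
    and "lam > 0"
    and "0 \<le> \<phi>" and "\<phi> < 1"
    and "is_relaxed_lasso X y lam \<phi> \<beta>_rel"
    and "\<forall>j\<in>equicorrelation_set X y lam. \<forall>k\<in>equicorrelation_set X y lam.
        (\<Sum>i<q. A i j * A i k) = \<phi> / (1 - \<phi>) * gram X $ j $ k"
    and "vec_support \<beta>_rel = equicorrelation_set X y lam"
    and "\<forall>j\<in>equicorrelation_set X y lam. sgn (\<beta>_rel $ j) = equicorrelation_sign X y lam j"
  shows "lasso_ridge X y lam q A = \<beta>_rel"
proof -
  define E where "E = equicorrelation_set X y lam"
  define b where "b = lasso X y lam"
  define r where "r = y - X *v b"
  define d0 where "d0 = \<beta>_rel - b"
  define N where "N = real CARD('n)"
  have N: "N > 0"
    by (simp add: N_def)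
  have off0: "vanishes_off E d0"
  proof -
    have "vanishes_off E b"
      using lasso_vanishes_off_equicorrelation_set[OF assms(2)] by (simp add: b_def E_def)
    moreover have "vanishes_off E \<beta>_rel"
      using assms(7) by (auto simp: E_def vanishes_off_def vec_support_def)
    ultimately show ?thesis
      by (simp add: d0_def vanishes_off_def)
  qed
  have col: "column j X \<bullet> (X *v d0) = (1 - \<phi>) * (column j X \<bullet> r)" if j: "j \<in> E" for j
  proof -
    have "\<beta>_rel $ j \<noteq> 0"
      using j assms(7) by (auto simp: E_def vec_support_def)
    \<comment> \<open>Both estimators share the signs \<open>s\<close> on \<open>E\<close>, so the
      relaxed residual correlations are \<open>\<phi>\<close> times the Lasso ones. Their difference
      produces the factor \<open>1 - \<phi>\<close>.\<close>
    then have "column j X \<bullet> (y - X *v \<beta>_rel) / N = \<phi> * lam * equicorrelation_sign X y lam j"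
      using penalized_least_squares_stationary[OF assms(5)[unfolded is_relaxed_lasso_def]] assms(8) j
      by (simp add: E_def N_def)
    also have "\<dots> = \<phi> * (column j X \<bullet> r / N)"
      using equicorrelation[of j X y lam] j by (simp add: E_def b_def r_def N_def)
    finally have "column j X \<bullet> (y - X *v \<beta>_rel) = \<phi> * (column j X \<bullet> r)"
      using N by simp
    moreover have "X *v d0 = r - (y - X *v \<beta>_rel)"
      by (simp add: d0_def r_def matrix_vector_mult_diff_distrib)
    ultimately show ?thesis
      by (simp only: inner_diff_right left_diff_distrib mult_1_left)
  qed
  define F where "F = (\<lambda>\<delta>. least_squares_loss X r \<delta> + 1 / 2 * (\<Sum>i<q. (\<Sum>j\<in>E. A i j * \<delta> $ j)\<^sup>2))"
  \<comment> \<open>The loss contributes one further copy of the squared fit, so its total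
    coefficient becomes \<open>1 / (1 - \<phi>)\<close>, matching that of the cross term.\<close>
  have a: "\<phi> / (1 - \<phi>) = 1 / (1 - \<phi>) - 1"
    using assms(4) by (simp add: field_simps)
  have F: "F d = F d0 + (norm (X *v (d - d0)))\<^sup>2 / (2 * N * (1 - \<phi>))"
    if off: "vanishes_off E d" for d
  proof -
    \<comment> \<open>Proved for every feasible \<open>d\<close>, so that it also applies to
      \<open>d0\<close>; the terms independent of \<open>d\<close> then cancel.\<close>
    have square: "F d = ((norm r)\<^sup>2 + ((norm (X *v (d - d0)))\<^sup>2 - (norm (X *v d0))\<^sup>2) / (1 - \<phi>)) / (2 * N)"
      if off: "vanishes_off E d" for d
    proof -
      \<comment> \<open>Expanding \<open>X *v d\<close> in columns meets only indices in
        \<open>E\<close>, where \<open>col\<close> applies.\<close>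
      have "(X *v d0) \<bullet> (X *v d) = (1 - \<phi>) * (r \<bullet> (X *v d))"
        unfolding inner_matrix_vector_mult[of _ X d] sum_vanishes_off[OF off] sum_distrib_left
        using col by (intro sum.cong) auto
      then have ip: "r \<bullet> (X *v d) = ((X *v d0) \<bullet> (X *v d)) / (1 - \<phi>)"
        using assms(4) by simp
      have "F d = ((norm (r - X *v d))\<^sup>2 + \<phi> / (1 - \<phi>) * (norm (X *v d))\<^sup>2) / (2 * N)"
        unfolding F_def least_squares_loss_def ridge_penalty_eq[OF assms(6)[folded E_def] off] N_def
        by (simp add: add_divide_distrib)
      also have "(norm (r - X *v d))\<^sup>2 = (norm r)\<^sup>2 - 2 * (r \<bullet> (X *v d)) + (norm (X *v d))\<^sup>2"
        by (simp add: power2_norm_eq_inner algebra_simps inner_commute)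
      also have "\<dots> + \<phi> / (1 - \<phi>) * (norm (X *v d))\<^sup>2
          = (norm r)\<^sup>2 + ((norm (X *v d))\<^sup>2 - 2 * ((X *v d0) \<bullet> (X *v d))) / (1 - \<phi>)"
        unfolding ip a by (simp add: left_diff_distrib diff_divide_distrib)
      also have "(norm (X *v d))\<^sup>2 - 2 * ((X *v d0) \<bullet> (X *v d))
          = (norm (X *v (d - d0)))\<^sup>2 - (norm (X *v d0))\<^sup>2"
        by (simp add: power2_norm_eq_inner matrix_vector_mult_diff_distrib algebra_simps inner_commute)
      finally show ?thesis .
    qed
    show ?thesis
      unfolding square[OF off] square[OF off0]
      by (simp add: add_divide_distrib diff_divide_distrib ac_simps)
  qed
  have pos: "2 * N * (1 - \<phi>) > 0"
    using N assms(4) by simp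
  \<comment> \<open>Identifying the choice term takes both halves: \<open>d0\<close> minimizes, and
    any minimizer has the same fit as \<open>d0\<close>, hence equals it by injectivity.\<close>
  have "arg_min F (vanishes_off E) = d0"
    unfolding arg_min_def
  proof (rule some_equality)
    have "F d0 \<le> F d" if "vanishes_off E d" for d
      unfolding F[OF that] using pos by simp
    with off0 show "is_arg_min F (vanishes_off E) d0"
      by (simp add: is_arg_min_linorder)
  next
    fix d
    assume "is_arg_min F (vanishes_off E) d"
    then have off: "vanishes_off E d" and "F d \<le> F d0"
      using off0 by (auto simp: is_arg_min_linorder)
    then have "(norm (X *v (d - d0)))\<^sup>2 / (2 * N * (1 - \<phi>)) \<le> 0"
      using F[OF off] by linarith
    then have "X *v (d - d0) = 0"
      using pos by (simp add: divide_le_0_iff)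
    moreover have "vanishes_off E (d - d0)"
      using off off0 by (simp add: vanishes_off_def)
    ultimately have "d - d0 = 0"
      unfolding E_def by (intro equicorrelation_injective[OF assms(1,2)])
    then show "d = d0"
      by simp
  qed
  then show ?thesis
    by (simp add: lasso_ridge_def lasso_ridge_correction_def F_def E_def r_def b_def d0_def)
qed

end
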